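(* Let $k$ be a field of characteristic different from $2$ and $3$, let $a,d\in k$ be distinct and non-zero, and let $E: ax^2+y^2=1+dx^2y^2$. For every integer $n\ge0$ the function $\psi_n(x,y)$ satisfies $$\psi_n(x,y)=\begin{cases}\dfrac{(a-d)^{k(n)}\,\tilde\psi_n(y)}{(2(1-y))^{m(n)}} & n\text{ odd},\\[2mm] \dfrac{(a-d)^{k(n)}\,\tilde\psi_n(y)}{x\,(2(1-y))^{m(n)}} & n\text{ even},\end{cases}$$ where $m(n)=\frac{n^2-1}{2}$ if $n$ is odd, $m(n)=\frac{n^2-2}{2}$ if $n$ is even, $k(n)=\left\lfloor\frac{3n^2}{8}\right\rfloor$, and $\tilde\psi_n=\tilde\psi_n(y)$ is defined by $\tilde\psi_0=0$, $\tilde\psi_1=1$, $\tilde\psi_2=y+1$, $\tilde\psi_3=-dy^4-2dy^3+2ay+a$, $\tilde\psi_4=-2y(y+1)(dy^4-a)=-2dy^6-2dy^5+2ay^2+2ay$, $$\tilde\psi_{2r+1}=\begin{cases}\dfrac{4(a-d)(a-dy^2)^2\tilde\psi_{r+2}\tilde\psi_r^3}{(y+1)^2}-\tilde\psi_{r-1}\tilde\psi_{r+1}^3 & r\equiv0\pmod 4,\ r\ge4,\\[2mm] \tilde\psi_{r+2}\tilde\psi_r^3-\dfrac{4(a-dy^2)^2\tilde\psi_{r-1}\tilde\psi_{r+1}^3}{(y+1)^2} & r\equiv1\pmod 4,\ r\ge5,\\[2mm] \dfrac{4(a-dy^2)^2\tilde\psi_{r+2}\tilde\psi_r^3}{(y+1)^2}-\tilde\psi_{r-1}\tilde\psi_{r+1}^3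 & r\equiv2\pmod 4,\ r\ge2,\\[2mm] \tilde\psi_{r+2}\tilde\psi_r^3-\dfrac{4(a-d)(a-dy^2)^2\tilde\psi_{r-1}\tilde\psi_{r+1}^3}{(y+1)^2} & r\equiv3\pmod 4,\ r\ge3,\end{cases}$$ and $$\tilde\psi_{2r}=\begin{cases}\dfrac{\tilde\psi_r}{y+1}\left(\tilde\psi_{r+2}\tilde\psi_{r-1}^2-\tilde\psi_{r-2}\tilde\psi_{r+1}^2\right) & r\equiv0\pmod 4,\ r\ge4,\\[2mm] \dfrac{\tilde\psi_r}{y+1}\left((a-d)\tilde\psi_{r+2}\tilde\psi_{r-1}^2-\tilde\psi_{r-2}\tilde\psi_{r+1}^2\right) & r\equiv1\pmod 4,\ r\ge5,\\[2mm] \dfrac{\tilde\psi_r}{y+1}\left(\tilde\psi_{r+2}\tilde\psi_{r-1}^2-\tilde\psi_{r-2}\tilde\psi_{r+1}^2\right) & r\equiv2\pmod 4,\ r\ge6,\\[2mm] \dfrac{\tilde\psi_r}{y+1}\left(\tilde\psi_{r+2}\tilde\psi_{r-1}^2-(a-d)\tilde\psi_{r-2}\tilde\psi_{r+1}^2\right) & r\equiv3\pmod 4,\ r\ge3.\end{cases}$$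
   Context: The function field $k(E)$ is the field of fractions of $k[x,y]/(ax^2+y^2-1-dx^2y^2)$ (the integer-valued function $k(n)$ in the claim is unrelated to the field $k$). The elements $\psi_n=\psi_n(x,y)$ of $k(E)$ are defined recursively for $n\ge 0$ by $\psi_0=0$, $\psi_1=1$, $\psi_2=\dfrac{(a-d)(1+y)}{x(2(1-y))}$, $\psi_3=\dfrac{(a-d)^3(a+2ay-2dy^3-dy^4)}{(2(1-y))^4}$, $\psi_4=\dfrac{2(a-d)^6y(1+y)(a-dy^4)}{x(2(1-y))^7}$, $\psi_{2m+1}=\psi_{m+2}\psi_m^3-\psi_{m-1}\psi_{m+1}^3$ for $m\ge 2$, $\psi_{2m}=\dfrac{\psi_m}{\psi_2}\left(\psi_{m+2}\psi_{m-1}^2-\psi_{m-2}\psi_{m+1}^2\right)$ for $m\ge 3$. The recursion for $\tilde\psi_n$ is carried out in the field of rational functions in $y$ over $k$; the asserted equalities are equalities in $k(E)$. *)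

theory Defs
  imports
    "HOL-Computational_Algebra.Computational_Algebra"
    "HOL-Algebra.QuotRing"
    "HOL-Algebra.Algebraic_Closure_Type"
begin

text \<open>The ring $k[x,y]$ is represented as $(k[x])[y]$: the outer variable is $y$.\<close>

definition const_poly :: "'k::field \<Rightarrow> 'k poly poly" where
  "const_poly c = [:[:c:]:]"

definition x_poly :: "'k::field poly poly" where
  "x_poly = [:[:0, 1:]:]"

definition y_poly :: "'k::field poly poly" where
  "y_poly = [:0, 1:]"

definition curve_poly :: "'k::field \<Rightarrow> 'k \<Rightarrow> 'k poly poly" where
  "curve_poly a d =
     const_poly a * x_poly ^ 2 + y_poly ^ 2 - 1 - const_poly d * x_poly ^ 2 * y_poly ^ 2"

abbreviation poly_ring_xy :: "'k::field poly poly ring" where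
  "poly_ring_xy \<equiv> ring_of_type_algebra"

definition curve_ideal :: "'k::field \<Rightarrow> 'k \<Rightarrow> 'k poly poly set" where
  "curve_ideal a d = PIdl\<^bsub>poly_ring_xy\<^esub> (curve_poly a d)"

definition coordinate_ring :: "'k::field \<Rightarrow> 'k \<Rightarrow> 'k poly poly set ring" where
  "coordinate_ring a d = poly_ring_xy Quot (curve_ideal a d)"

text \<open>The type \<open>'f\<close>, together with the embedding \<open>\<iota>\<close>, is a field of fractions of \<open>R\<close>. Since a type
  cannot depend on \<open>a\<close> and \<open>d\<close>, the function field is treated as an arbitrary field of fractions
  of the coordinate ring; it is unique up to unique isomorphism.\<close>

definition is_fraction_field :: "('r, 'm) ring_scheme \<Rightarrow> ('r \<Rightarrow> 'f::field) \<Rightarrow> bool" where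
  "is_fraction_field R \<iota> \<longleftrightarrow>
     \<iota> \<in> ring_hom R ring_of_type_algebra \<and>
     inj_on \<iota> (carrier R) \<and>
     (\<forall>z. \<exists>p\<in>carrier R. \<exists>q\<in>carrier R. q \<noteq> \<zero>\<^bsub>R\<^esub> \<and> z = \<iota> p / \<iota> q)"

definition is_function_field :: "'k::field \<Rightarrow> 'k \<Rightarrow> ('k poly poly set \<Rightarrow> 'f::field) \<Rightarrow> bool" where
  "is_function_field a d \<iota> \<longleftrightarrow> is_fraction_field (coordinate_ring a d) \<iota>"

definition ff_of_poly ::
    "'k::field \<Rightarrow> 'k \<Rightarrow> ('k poly poly set \<Rightarrow> 'f::field) \<Rightarrow> 'k poly poly \<Rightarrow> 'f" where
  "ff_of_poly a d \<iota> p = \<iota> (curve_ideal a d +>\<^bsub>poly_ring_xy\<^esub> p)"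

definition ff_const :: "'k::field \<Rightarrow> 'k \<Rightarrow> ('k poly poly set \<Rightarrow> 'f::field) \<Rightarrow> 'k \<Rightarrow> 'f" where
  "ff_const a d \<iota> c = ff_of_poly a d \<iota> (const_poly c)"

definition ff_x :: "'k::field \<Rightarrow> 'k \<Rightarrow> ('k poly poly set \<Rightarrow> 'f::field) \<Rightarrow> 'f" where
  "ff_x a d \<iota> = ff_of_poly a d \<iota> x_poly"

definition ff_y :: "'k::field \<Rightarrow> 'k \<Rightarrow> ('k poly poly set \<Rightarrow> 'f::field) \<Rightarrow> 'f" where
  "ff_y a d \<iota> = ff_of_poly a d \<iota> y_poly"

text \<open>The value at \<open>z\<close> of a rational function over \<open>'k\<close> without pole at \<open>z\<close>, where \<open>c\<close> embeds \<open>'k\<close>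
  into the field containing \<open>z\<close>. For \<open>z\<close> transcendental over \<open>'k\<close> this is the embedding of
  the rational function field that sends the variable to \<open>z\<close>.\<close>

definition rat_eval :: "('k::field \<Rightarrow> 'f::field) \<Rightarrow> 'f \<Rightarrow> 'k poly fract \<Rightarrow> 'f" where
  "rat_eval c z r =
     (THE w. \<exists>p q. r = Fract p q \<and> poly (map_poly c q) z \<noteq> 0 \<and>
                   w = poly (map_poly c p) z / poly (map_poly c q) z)"

lemma recursion_cases:
  fixes n :: nat
  obtains "n = 0" | "n = 1" | "n = 2" | "n = 3" | "n = 4"
    | m where "m \<ge> 2" "n = 2 * m + 1" | m where "m \<ge> 3" "n = 2 * m"
proof -
  have "n = 0 \<or> n = 1 \<or> n = 2 \<or> n = 3 \<or> n = 4 \<or> (\<exists>m\<ge>2. n = 2 * m + 1) \<or> (\<exists>m\<ge>3. n = 2 * m)"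
    by presburger
  then show thesis using that by blast
qed

text \<open>Both recursions only use field operations, so they are defined over an arbitrary field
  containing the parameters.\<close>

function psi :: "'f::field \<Rightarrow> 'f \<Rightarrow> 'f \<Rightarrow> 'f \<Rightarrow> nat \<Rightarrow> 'f" where
  "psi a d x y 0 = 0"
| "psi a d x y 1 = 1"
| "psi a d x y 2 = (a - d) * (1 + y) / (x * (2 * (1 - y)))"
| "psi a d x y 3 =
     (a - d) ^ 3 * (a + 2 * a * y - 2 * d * y ^ 3 - d * y ^ 4) / (2 * (1 - y)) ^ 4"
| "psi a d x y 4 =
     2 * (a - d) ^ 6 * y * (1 + y) * (a - d * y ^ 4) / (x * (2 * (1 - y)) ^ 7)"
| "m \<ge> 2 \<Longrightarrow> psi a d x y (2 * m + 1) =
     psi a d x y (m + 2) * psi a d x y m ^ 3 - psi a d x y (m - 1) * psi a d x y (m + 1) ^ 3"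
| "m \<ge> 3 \<Longrightarrow> psi a d x y (2 * m) =
     psi a d x y m / psi a d x y 2 *
       (psi a d x y (m + 2) * psi a d x y (m - 1) ^ 2 -
        psi a d x y (m - 2) * psi a d x y (m + 1) ^ 2)"
proof goal_cases
  case (1 P t)
  obtain a d x y n where t: "t = (a, d, x, y, n)" by (cases t)
  show ?case
    by (rule recursion_cases[of n],
        rule 1(1), simp add: t,
        rule 1(2), simp add: t,
        rule 1(3), simp add: t,
        rule 1(4), simp add: t,
        rule 1(5), simp add: t,
        rule 1(6), assumption, simp add: t,
        rule 1(7), assumption, simp add: t)
qed (simp only: prod.inject; elim conjE; (rule FalseE, presburger | simp))+
termination by (relation "measure (\<lambda>(a, d, x, y, n). n)") auto

function psi_tilde :: "'f::field \<Rightarrow> 'f \<Rightarrow> 'f \<Rightarrow> nat \<Rightarrow> 'f" where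
  "psi_tilde a d y 0 = 0"
| "psi_tilde a d y 1 = 1"
| "psi_tilde a d y 2 = y + 1"
| "psi_tilde a d y 3 = - d * y ^ 4 - 2 * d * y ^ 3 + 2 * a * y + a"
| "psi_tilde a d y 4 = - 2 * y * (y + 1) * (d * y ^ 4 - a)"
| "r \<ge> 2 \<Longrightarrow> psi_tilde a d y (2 * r + 1) =
     (if r mod 4 = 0 then
        4 * (a - d) * (a - d * y ^ 2) ^ 2 * psi_tilde a d y (r + 2) * psi_tilde a d y r ^ 3
          / (y + 1) ^ 2
        - psi_tilde a d y (r - 1) * psi_tilde a d y (r + 1) ^ 3
      else if r mod 4 = 1 then
        psi_tilde a d y (r + 2) * psi_tilde a d y r ^ 3
        - 4 * (a - d * y ^ 2) ^ 2 * psi_tilde a d y (r - 1) * psi_tilde a d y (r + 1) ^ 3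
          / (y + 1) ^ 2
      else if r mod 4 = 2 then
        4 * (a - d * y ^ 2) ^ 2 * psi_tilde a d y (r + 2) * psi_tilde a d y r ^ 3
          / (y + 1) ^ 2
        - psi_tilde a d y (r - 1) * psi_tilde a d y (r + 1) ^ 3
      else
        psi_tilde a d y (r + 2) * psi_tilde a d y r ^ 3
        - 4 * (a - d) * (a - d * y ^ 2) ^ 2 * psi_tilde a d y (r - 1) * psi_tilde a d y (r + 1) ^ 3
          / (y + 1) ^ 2)"
| "r \<ge> 3 \<Longrightarrow> psi_tilde a d y (2 * r) =
     (if r mod 4 = 0 then
        psi_tilde a d y r / (y + 1) *
          (psi_tilde a d y (r + 2) * psi_tilde a d y (r - 1) ^ 2
           - psi_tilde a d y (r - 2) * psi_tilde a d y (r + 1) ^ 2)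
      else if r mod 4 = 1 then
        psi_tilde a d y r / (y + 1) *
          ((a - d) * psi_tilde a d y (r + 2) * psi_tilde a d y (r - 1) ^ 2
           - psi_tilde a d y (r - 2) * psi_tilde a d y (r + 1) ^ 2)
      else if r mod 4 = 2 then
        psi_tilde a d y r / (y + 1) *
          (psi_tilde a d y (r + 2) * psi_tilde a d y (r - 1) ^ 2
           - psi_tilde a d y (r - 2) * psi_tilde a d y (r + 1) ^ 2)
      else
        psi_tilde a d y r / (y + 1) *
          (psi_tilde a d y (r + 2) * psi_tilde a d y (r - 1) ^ 2
           - (a - d) * psi_tilde a d y (r - 2) * psi_tilde a d y (r + 1) ^ 2))"
proof goal_cases
  case (1 P t)
  obtain a d y n where t: "t = (a, d, y, n)" by (cases t)
  show ?case
    by (rule recursion_cases[of n],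
        rule 1(1), simp add: t,
        rule 1(2), simp add: t,
        rule 1(3), simp add: t,
        rule 1(4), simp add: t,
        rule 1(5), simp add: t,
        rule 1(6), assumption, simp add: t,
        rule 1(7), assumption, simp add: t)
qed (simp only: prod.inject; elim conjE; (rule FalseE, presburger | simp))+
termination by (relation "measure (\<lambda>(a, d, y, n). n)") auto

definition psi_ff :: "'k::field \<Rightarrow> 'k \<Rightarrow> ('k poly poly set \<Rightarrow> 'f::field) \<Rightarrow> nat \<Rightarrow> 'f" where
  "psi_ff a d \<iota> n =
     psi (ff_const a d \<iota> a) (ff_const a d \<iota> d) (ff_x a d \<iota>) (ff_y a d \<iota>) n"

definition psi_tilde_rat :: "'k::field \<Rightarrow> 'k \<Rightarrow> nat \<Rightarrow> 'k poly fract" where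
  "psi_tilde_rat a d n = psi_tilde (Fract [:a:] 1) (Fract [:d:] 1) (Fract [:0, 1:] 1) n"

definition psi_tilde_ff :: "'k::field \<Rightarrow> 'k \<Rightarrow> ('k poly poly set \<Rightarrow> 'f::field) \<Rightarrow> nat \<Rightarrow> 'f" where
  "psi_tilde_ff a d \<iota> n = rat_eval (ff_const a d \<iota>) (ff_y a d \<iota>) (psi_tilde_rat a d n)"

text \<open>An integer, because \<open>m_exp 0 = -1\<close>.\<close>

definition m_exp :: "nat \<Rightarrow> int" where
  "m_exp n = (if odd n then (int n ^ 2 - 1) div 2 else (int n ^ 2 - 2) div 2)"

definition k_exp :: "nat \<Rightarrow> nat" where
  "k_exp n = 3 * n ^ 2 div 8"

end

theory Submission
  imports Defs
begin

text \<open>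
  Put $u = a-d$, $s = 2(1-y)$ and let \<open>gauge u s x n\<close> be $u^{k(n)}s^{-m(n)}$, divided by $x$ for
  even $n$. The claim is \<open>\<psi>\<^sub>n = gauge u s x n * \<psi>~\<^sub>n\<close>. Substituted into the recursion for
  \<open>\<psi>\<close>, it becomes the recursion for \<open>\<psi>~\<close> as soon as the products of scaling factors are known,
  and these depend only on how $k$, $m$ and the parity behave under the shifts of the index. The exponents
  are quadratic in $n$ up to rounding, so the main terms cancel. Rounding in
  $k(n)=\<lfloor>3n^2/8\<rfloor>$ leaves a factor $u$ for certain residues of $r$ modulo $4$. In the
  recursion for the index $2r+1$, the product of four functions of even index leaves $s^2/x^4$,
  which on the curve equals $4(a-dy^2)^2/(y+1)^2$ (\<open>gauge_odd_recurrence\<close>,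
  \<open>gauge_even_recurrence\<close>). The resulting identity \<open>psi_eq_gauge_psi_tilde\<close> holds in every field of
  characteristic other than $2$, for $a \<noteq> d$ and all points on the curve with $x \<noteq> 0$ and $y \<noteq> \<plusminus>1$.

  It remains to apply it to the generic point. No nonzero multiple of the equation of the curve is
  $x$ or a polynomial in $y$ alone (\<open>degree_lead_coeff_curve_multiple\<close>); hence in the function
  field $x \<noteq> 0$ and $y$ is transcendental over $k$, in particular different from $\<plusminus>1$.
  Transcendence also makes \<open>rat_eval\<close> a homomorphism from $k(y)$ to the function field, under which
  the recursion for \<open>\<psi>~\<close> in $k(y)$ becomes the same recursion in the function field
  (\<open>rat_eval_psi_tilde\<close>).
\<close>

section \<open>The scaling factor between the two recursions\<close>

lemma k_exp_by_residue:
  "k_exp (4 * q) = 6 * q ^ 2"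
  "k_exp (4 * q + 1) = 6 * q ^ 2 + 3 * q"
  "k_exp (4 * q + 2) = 6 * q ^ 2 + 6 * q + 1"
  "k_exp (4 * q + 3) = 6 * q ^ 2 + 9 * q + 3"
proof -
  have "3 * (4 * q) ^ 2 = 8 * (6 * q ^ 2)"
    "3 * (4 * q + 1) ^ 2 = 8 * (6 * q ^ 2 + 3 * q) + 3"
    "3 * (4 * q + 2) ^ 2 = 8 * (6 * q ^ 2 + 6 * q + 1) + 4"
    "3 * (4 * q + 3) ^ 2 = 8 * (6 * q ^ 2 + 9 * q + 3) + 3"
    by (simp_all add: power2_eq_square algebra_simps)
  then show "k_exp (4 * q) = 6 * q ^ 2"
    "k_exp (4 * q + 1) = 6 * q ^ 2 + 3 * q"
    "k_exp (4 * q + 2) = 6 * q ^ 2 + 6 * q + 1"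
    "k_exp (4 * q + 3) = 6 * q ^ 2 + 9 * q + 3"
    by (simp_all add: k_exp_def)
qed

text \<open>The exponent of \<open>a - d\<close> is $3n^2/8$ up to rounding. The quadratic main terms of the two
  sides agree, because $(r+2)^2+3r^2$, $(r-1)^2+3(r+1)^2$ and $(2r+1)^2$ differ by constants only,
  and likewise in the even case, where the extra $1$ is the exponent of the divisor \<open>psi\<close> at
  index $2$. The roundings leave a defect that is $0$ or $1$ according to
  \<open>r mod 4\<close>; where it is $1$, the recursion for \<open>psi_tilde\<close> has an explicit factor \<open>a - d\<close>.\<close>

lemma k_exp_recurrences:
  assumes "r \<ge> 2"
  shows "k_exp (r + 2) + 3 * k_exp r
           = k_exp (2 * r + 1) + (if r mod 4 = 0 then 1 else 0)" (is ?odd_minuend)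
    and "k_exp (r - 1) + 3 * k_exp (r + 1)
           = k_exp (2 * r + 1) + (if r mod 4 = 3 then 1 else 0)" (is ?odd_subtrahend)
    and "k_exp r + k_exp (r + 2) + 2 * k_exp (r - 1)
           = k_exp (2 * r) + 1 + (if r mod 4 = 1 then 1 else 0)" (is ?even_minuend)
    and "k_exp r + k_exp (r - 2) + 2 * k_exp (r + 1)
           = k_exp (2 * r) + 1 + (if r mod 4 = 3 then 1 else 0)" (is ?even_subtrahend)
proof -
  have "\<exists>q. r = 4 * (q + 1) \<or> r = 4 * (q + 1) + 1 \<or> r = 4 * q + 2 \<or> r = 4 * q + 3"
    using assms by presburger
  then obtain q where "r = 4 * (q + 1) \<or> r = 4 * (q + 1) + 1 \<or> r = 4 * q + 2 \<or> r = 4 * q + 3"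
    by blast
  then have "?odd_minuend \<and> ?odd_subtrahend \<and> ?even_minuend \<and> ?even_subtrahend"
  proof (elim disjE)
    assume r: "r = 4 * (q + 1)"
    then have indices: "r + 2 = 4 * (q + 1) + 2" "r - 1 = 4 * q + 3" "r + 1 = 4 * (q + 1) + 1"
      "r - 2 = 4 * q + 2" "2 * r = 4 * (2 * q + 2)"
      by simp_all
    have residue: "r mod 4 = 0"
      using r by presburger
    show ?thesis
      unfolding indices residue unfolding r k_exp_by_residue
      by (simp add: power2_eq_square algebra_simps)
  next
    assume r: "r = 4 * (q + 1) + 1"
    then have indices: "r + 2 = 4 * (q + 1) + 3" "r - 1 = 4 * (q + 1)" "r + 1 = 4 * (q + 1) + 2"
      "r - 2 = 4 * q + 3" "2 * r = 4 * (2 * q + 2) + 2" "4 * (2 * q + 2) + 2 + 1 = 4 * (2 * q + 2) + 3"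
      by simp_all
    have residue: "r mod 4 = 1"
      using r by presburger
    show ?thesis
      unfolding indices residue unfolding r k_exp_by_residue
      by (simp add: power2_eq_square algebra_simps)
  next
    assume r: "r = 4 * q + 2"
    then have indices: "r + 2 = 4 * (q + 1)" "r - 1 = 4 * q + 1" "r + 1 = 4 * q + 3"
      "r - 2 = 4 * q" "2 * r = 4 * (2 * q + 1)"
      by simp_all
    have residue: "r mod 4 = 2"
      using r by presburger
    show ?thesis
      unfolding indices residue unfolding r k_exp_by_residue
      by (simp add: power2_eq_square algebra_simps)
  next
    assume r: "r = 4 * q + 3"
    then have indices: "r + 2 = 4 * (q + 1) + 1" "r - 1 = 4 * q + 2" "r + 1 = 4 * (q + 1)"
      "r - 2 = 4 * q + 1" "2 * r = 4 * (2 * q + 1) + 2" "4 * (2 * q + 1) + 2 + 1 = 4 * (2 * q + 1) + 3"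
      by simp_all
    have residue: "r mod 4 = 3"
      using r by presburger
    show ?thesis
      unfolding indices residue unfolding r k_exp_by_residue
      by (simp add: power2_eq_square algebra_simps)
  qed
  then show ?odd_minuend ?odd_subtrahend ?even_minuend ?even_subtrahend
    by blast+
qed

lemma m_exp_by_parity:
  "m_exp (2 * q) = 2 * int q ^ 2 - 1"
  "m_exp (2 * q + 1) = 2 * int q ^ 2 + 2 * int q"
proof -
  have "int (2 * q) ^ 2 - 2 = 2 * (2 * int q ^ 2 - 1)"
    "int (2 * q + 1) ^ 2 - 1 = 2 * (2 * int q ^ 2 + 2 * int q)"
    by (simp_all add: power2_eq_square algebra_simps)
  then show "m_exp (2 * q) = 2 * int q ^ 2 - 1"
    "m_exp (2 * q + 1) = 2 * int q ^ 2 + 2 * int q"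
    by (simp_all add: m_exp_def)
qed

text \<open>In the odd recursion the product of four functions of even index falls short by $2$ in the
  exponent of $2(1-y)$. In the even recursion the division by \<open>psi\<close> at index $2$ removes the
  surplus $1$.\<close>

lemma m_exp_recurrences:
  assumes "r \<ge> 2"
  shows "m_exp (r + 2) + 3 * m_exp r
           = m_exp (2 * r + 1) - (if even r then 2 else 0)" (is ?odd_minuend)
    and "m_exp (r - 1) + 3 * m_exp (r + 1)
           = m_exp (2 * r + 1) - (if odd r then 2 else 0)" (is ?odd_subtrahend)
    and "m_exp r + m_exp (r + 2) + 2 * m_exp (r - 1) = m_exp (2 * r) + 1" (is ?even_minuend)
    and "m_exp r + m_exp (r - 2) + 2 * m_exp (r + 1) = m_exp (2 * r) + 1" (is ?even_subtrahend)
proof -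
  have "\<exists>q. r = 2 * (q + 1) \<or> r = 2 * (q + 1) + 1"
    using assms by presburger
  then obtain q where "r = 2 * (q + 1) \<or> r = 2 * (q + 1) + 1"
    by blast
  then have "?odd_minuend \<and> ?odd_subtrahend \<and> ?even_minuend \<and> ?even_subtrahend"
  proof (elim disjE)
    assume r: "r = 2 * (q + 1)"
    then have indices: "r + 2 = 2 * (q + 2)" "r - 1 = 2 * q + 1" "r + 1 = 2 * (q + 1) + 1"
      "r - 2 = 2 * q"
      by simp_all
    show ?thesis
      unfolding m_exp_by_parity[of r] indices unfolding r m_exp_by_parity
      by (simp add: power2_eq_square algebra_simps)
  next
    assume r: "r = 2 * (q + 1) + 1"
    then have indices: "r + 2 = 2 * (q + 2) + 1" "r - 1 = 2 * (q + 1)" "r + 1 = 2 * (q + 2)"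
      "r - 2 = 2 * q + 1"
      by simp_all
    show ?thesis
      unfolding m_exp_by_parity[of r] indices unfolding r m_exp_by_parity
      by (simp add: power2_eq_square algebra_simps)
  qed
  then show ?odd_minuend ?odd_subtrahend ?even_minuend ?even_subtrahend
    by blast+
qed

text \<open>The ratio of \<open>psi\<close> to \<open>psi_tilde\<close>; the parameters \<open>u\<close> and \<open>s\<close> stand for $a-d$ and
  $2(1-y)$.\<close>

definition gauge :: "'f::field \<Rightarrow> 'f \<Rightarrow> 'f \<Rightarrow> nat \<Rightarrow> 'f" where
  "gauge u s x n = u ^ k_exp n / ((if even n then x else 1) * s powi m_exp n)"

text \<open>The recursion for \<open>psi_tilde\<close> arises from that for \<open>psi\<close> by dividing out \<open>gauge\<close>. The
  factors on the right-hand sides are what remains in front of the two products. The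
  factor $s^2/x^4$ is present when the product has four denominators \<open>x\<close>, of which the odd index
  $2r+1$ on the right absorbs none.\<close>

lemma gauge_odd_recurrence:
  assumes "r \<ge> 2" and "s \<noteq> 0"
  shows "gauge u s x (r + 2) * gauge u s x r ^ 3 =
           gauge u s x (2 * r + 1) * (if r mod 4 = 0 then u else 1)
             * (if even r then s ^ 2 / x ^ 4 else 1)"
    and "gauge u s x (r - 1) * gauge u s x (r + 1) ^ 3 =
           gauge u s x (2 * r + 1) * (if r mod 4 = 3 then u else 1)
             * (if odd r then s ^ 2 / x ^ 4 else 1)"
proof -
  have even_shift: "even (r + 2) \<longleftrightarrow> even r" "even (r - 1) \<longleftrightarrow> odd r" "even (r + 1) \<longleftrightarrow> odd r"
    using assms(1) by simp_all
  \<comment> \<open>Here \<open>z\<close> is the factor $1$ or \<open>x\<close> in the denominator, common to both indices because they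
    have the same parity.\<close>
  have collect: "(p / (z * q)) * (p' / (z * q')) ^ 3 = (p * p' ^ 3) / (z ^ 4 * (q * q' ^ 3))"
    for p p' q q' z :: 'a
    by (simp add: power_divide power_mult_distrib eval_nat_numeral mult_ac)
  have k: "u ^ k_exp (r + 2) * (u ^ k_exp r) ^ 3
      = u ^ k_exp (2 * r + 1) * (if r mod 4 = 0 then u else 1)"
    unfolding power_mult[symmetric] power_add[symmetric] mult.commute[of _ 3]
      k_exp_recurrences(1)[OF assms(1)]
    by (simp add: power_add)
  have m: "s powi m_exp (r + 2) * (s powi m_exp r) ^ 3
      = s powi m_exp (2 * r + 1) / (if even r then s ^ 2 else 1)"
    using arg_cong[OF m_exp_recurrences(1)[OF assms(1)], of "\<lambda>k. s powi k"] assms(2)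
    by (simp add: power_int_add power_int_diff power_int_mult mult.commute[of 3] split: if_splits)
  show "gauge u s x (r + 2) * gauge u s x r ^ 3 =
           gauge u s x (2 * r + 1) * (if r mod 4 = 0 then u else 1)
             * (if even r then s ^ 2 / x ^ 4 else 1)"
    unfolding gauge_def even_shift collect k m by (cases "even r") simp_all
  have k: "u ^ k_exp (r - 1) * (u ^ k_exp (r + 1)) ^ 3
      = u ^ k_exp (2 * r + 1) * (if r mod 4 = 3 then u else 1)"
    unfolding power_mult[symmetric] power_add[symmetric] mult.commute[of _ 3]
      k_exp_recurrences(2)[OF assms(1)]
    by (simp add: power_add)
  have m: "s powi m_exp (r - 1) * (s powi m_exp (r + 1)) ^ 3
      = s powi m_exp (2 * r + 1) / (if odd r then s ^ 2 else 1)"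
    using arg_cong[OF m_exp_recurrences(2)[OF assms(1)], of "\<lambda>k. s powi k"] assms(2)
    by (simp add: power_int_add power_int_diff power_int_mult mult.commute[of 3] split: if_splits)
  show "gauge u s x (r - 1) * gauge u s x (r + 1) ^ 3 =
           gauge u s x (2 * r + 1) * (if r mod 4 = 3 then u else 1)
             * (if odd r then s ^ 2 / x ^ 4 else 1)"
    unfolding gauge_def even_shift collect k m by (cases "even r") simp_all
qed

lemma gauge_2: "gauge u s x 2 = u / (x * s)"
  by (simp add: gauge_def k_exp_def m_exp_def)

text \<open>Here no power of \<open>x\<close> is left over. For even \<open>r\<close> the factors of index \<open>r\<close> and \<open>r \<plusminus> 2\<close> have
  a denominator \<open>x\<close> each, for odd \<open>r\<close> the squared factor contributes $x^2$ to the denominator. In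
  both cases the division by \<open>gauge u s x 2\<close> cancels one \<open>x\<close>, which leaves the single one that
  the even index \<open>2 * r\<close> requires.\<close>

lemma gauge_even_recurrence:
  assumes "r \<ge> 2" and "s \<noteq> 0" and "x \<noteq> 0" and "u \<noteq> 0"
  shows "gauge u s x r / gauge u s x 2 * (gauge u s x (r + 2) * gauge u s x (r - 1) ^ 2) =
           gauge u s x (2 * r) * (if r mod 4 = 1 then u else 1)"
    and "gauge u s x r / gauge u s x 2 * (gauge u s x (r - 2) * gauge u s x (r + 1) ^ 2) =
           gauge u s x (2 * r) * (if r mod 4 = 3 then u else 1)"
proof -
  have even_shift: "even (r + 2) \<longleftrightarrow> even r" "even (r - 1) \<longleftrightarrow> odd r"
    "even (r - 2) \<longleftrightarrow> even r" "even (r + 1) \<longleftrightarrow> odd r"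
    using assms(1) by simp_all
  \<comment> \<open>Here \<open>z\<close> and \<open>z'\<close> are the factors $1$ and \<open>x\<close> in the denominators, one for either parity.
    Whichever is which, \<open>z * z'\<close> is \<open>x\<close>.\<close>
  have collect: "(p / (z * q)) * ((p' / (z * q')) * (p'' / (z' * q'')) ^ 2)
      = (p * p' * p'' ^ 2) / ((z * z') ^ 2 * (q * q' * q'' ^ 2))"
    for p p' p'' q q' q'' z z' :: 'a
    by (simp add: power_divide power_mult_distrib eval_nat_numeral mult_ac)
  have k: "u ^ k_exp r * u ^ k_exp (r + 2) * (u ^ k_exp (r - 1)) ^ 2
      = u ^ k_exp (2 * r) * u * (if r mod 4 = 1 then u else 1)"
    unfolding power_mult[symmetric] power_add[symmetric] mult.commute[of _ 2]
      k_exp_recurrences(3)[OF assms(1)]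
    by (simp add: power_add)
  have m: "s powi m_exp r * s powi m_exp (r + 2) * (s powi m_exp (r - 1)) ^ 2
      = s powi m_exp (2 * r) * s"
    using arg_cong[OF m_exp_recurrences(3)[OF assms(1)], of "\<lambda>k. s powi k"] assms(2)
    by (simp add: power_int_add power_int_mult mult.commute[of 2])
  have "gauge u s x r * (gauge u s x (r + 2) * gauge u s x (r - 1) ^ 2) =
           gauge u s x (2 * r) * (if r mod 4 = 1 then u else 1) * gauge u s x 2"
    unfolding gauge_2 unfolding gauge_def even_shift collect k m using assms
    by (cases "even r") (simp_all add: power2_eq_square)
  then show "gauge u s x r / gauge u s x 2 * (gauge u s x (r + 2) * gauge u s x (r - 1) ^ 2) =
           gauge u s x (2 * r) * (if r mod 4 = 1 then u else 1)"
    using assms by (simp add: gauge_2 field_simps)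
  have k: "u ^ k_exp r * u ^ k_exp (r - 2) * (u ^ k_exp (r + 1)) ^ 2
      = u ^ k_exp (2 * r) * u * (if r mod 4 = 3 then u else 1)"
    unfolding power_mult[symmetric] power_add[symmetric] mult.commute[of _ 2]
      k_exp_recurrences(4)[OF assms(1)]
    by (simp add: power_add)
  have m: "s powi m_exp r * s powi m_exp (r - 2) * (s powi m_exp (r + 1)) ^ 2
      = s powi m_exp (2 * r) * s"
    using arg_cong[OF m_exp_recurrences(4)[OF assms(1)], of "\<lambda>k. s powi k"] assms(2)
    by (simp add: power_int_add power_int_mult mult.commute[of 2])
  have "gauge u s x r * (gauge u s x (r - 2) * gauge u s x (r + 1) ^ 2) =
           gauge u s x (2 * r) * (if r mod 4 = 3 then u else 1) * gauge u s x 2"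
    unfolding gauge_2 unfolding gauge_def even_shift collect k m using assms
    by (cases "even r") (simp_all add: power2_eq_square)
  then show "gauge u s x r / gauge u s x 2 * (gauge u s x (r - 2) * gauge u s x (r + 1) ^ 2) =
           gauge u s x (2 * r) * (if r mod 4 = 3 then u else 1)"
    using assms by (simp add: gauge_2 field_simps)
qed

section \<open>The identity in a field with a point on the curve\<close>

text \<open>By strong induction along the recursions. The equation of the curve enters only through
  $x^2(a-dy^2)=(1-y)(1+y)$, whose square turns the leftover factor $s^2/x^4$ into the factor
  $4(a-dy^2)^2/(y+1)^2$ of the recursion for \<open>psi_tilde\<close>.\<close>

lemma psi_eq_gauge_psi_tilde:
  fixes a d x y :: "'f::field"
  assumes curve: "a * x ^ 2 + y ^ 2 = 1 + d * x ^ 2 * y ^ 2"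
    and nz: "x \<noteq> 0" "y \<noteq> 1" "y \<noteq> - 1" "(2::'f) \<noteq> 0" "a \<noteq> d"
  shows "psi a d x y n = gauge (a - d) (2 * (1 - y)) x n * psi_tilde a d y n"
proof (induction n rule: less_induct)
  case (less n)
  define s where "s = 2 * (1 - y)"
  define u where "u = a - d"
  define g where "g = gauge u s x"
  define T where "T = psi_tilde a d y"
  have s: "s \<noteq> 0" and u: "u \<noteq> 0" and y: "y + 1 \<noteq> 0"
    using nz by (auto simp: s_def u_def eq_neg_iff_add_eq_0)
  have "x ^ 2 * (a - d * y ^ 2) = (1 - y) * (1 + y)"
    using curve by (simp add: algebra_simps power2_eq_square)
  then have "2 * (x ^ 2 * (a - d * y ^ 2)) = s * (y + 1)"
    by (simp only: s_def) (simp add: algebra_simps)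
  then have "(2 * (x ^ 2 * (a - d * y ^ 2))) ^ 2 = (s * (y + 1)) ^ 2"
    by (rule arg_cong)
  then have "4 * (a - d * y ^ 2) ^ 2 * x ^ 4 = s ^ 2 * (y + 1) ^ 2"
    by (simp add: power_mult_distrib mult_ac)
  then have quartic: "s ^ 2 / x ^ 4 = 4 * (a - d * y ^ 2) ^ 2 / (y + 1) ^ 2"
    using y nz by (simp add: field_simps)
  have IH: "psi a d x y k = g k * T k" if "k < n" for k
    using less.IH[OF that] by (simp add: g_def T_def s_def u_def)
  have "psi a d x y n = g n * T n"
  proof (cases n rule: recursion_cases)
    case 2
    then show ?thesis
      by (simp only: psi.simps psi_tilde.simps g_def T_def gauge_def k_exp_def m_exp_def) simp
  next
    case 3
    then show ?thesis
      by (simp only: psi.simps psi_tilde.simps g_def T_def gauge_2)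
        (simp add: s_def u_def add.commute)
  next
    case 4
    have "g 3 = u ^ 3 / s ^ 4"
      by (simp add: g_def gauge_def k_exp_def m_exp_def)
    moreover have "T 3 = a + 2 * a * y - 2 * d * y ^ 3 - d * y ^ 4"
      by (simp only: T_def psi_tilde.simps) (simp add: algebra_simps)
    ultimately show ?thesis
      by (simp only: 4 psi.simps times_divide_eq_left flip: s_def u_def)
  next
    case 5
    have "g 4 = u ^ 6 / (x * s ^ 7)"
      by (simp add: g_def gauge_def k_exp_def m_exp_def)
    moreover have "T 4 = 2 * y * (1 + y) * (a - d * y ^ 4)"
      by (simp only: T_def psi_tilde.simps) (simp add: algebra_simps)
    ultimately show ?thesis
      by (simp only: 5 psi.simps times_divide_eq_left flip: s_def u_def) (simp only: mult_ac)
  next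
    case (6 r)
    have ih: "psi a d x y (r + 2) = g (r + 2) * T (r + 2)" "psi a d x y r = g r * T r"
      "psi a d x y (r - 1) = g (r - 1) * T (r - 1)" "psi a d x y (r + 1) = g (r + 1) * T (r + 1)"
      by (rule IH; use 6 in simp)+
    have "psi a d x y n = (g (r + 2) * g r ^ 3) * (T (r + 2) * T r ^ 3)
        - (g (r - 1) * g (r + 1) ^ 3) * (T (r - 1) * T (r + 1) ^ 3)"
      unfolding \<open>n = 2 * r + 1\<close> psi.simps(6)[OF \<open>r \<ge> 2\<close>] ih
      by (simp only: power_mult_distrib mult_ac)
    also have "\<dots> = g n * T n"
    proof -
      have "r mod 4 = 0 \<and> even r \<or> r mod 4 = 1 \<and> odd r \<or> r mod 4 = 2 \<and> even r
          \<or> r mod 4 = 3 \<and> odd r"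
        by presburger
      then show ?thesis
        unfolding \<open>n = 2 * r + 1\<close> g_def gauge_odd_recurrence[OF \<open>r \<ge> 2\<close> s] quartic
          T_def psi_tilde.simps(6)[OF \<open>r \<ge> 2\<close>] u_def
        by (elim disjE conjE) (simp_all add: right_diff_distrib mult_ac)
    qed
    finally show ?thesis .
  next
    case (7 r)
    have ih: "psi a d x y (r + 2) = g (r + 2) * T (r + 2)" "psi a d x y r = g r * T r"
      "psi a d x y (r - 1) = g (r - 1) * T (r - 1)" "psi a d x y (r + 1) = g (r + 1) * T (r + 1)"
      "psi a d x y (r - 2) = g (r - 2) * T (r - 2)" "psi a d x y 2 = g 2 * T 2"
      by (rule IH; use 7 in simp)+
    have r: "r \<ge> 2"
      using 7 by simp
    have "psi a d x y n = (g r * T r) / (g 2 * (y + 1))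
         * (g (r + 2) * T (r + 2) * (g (r - 1) * T (r - 1)) ^ 2
            - g (r - 2) * T (r - 2) * (g (r + 1) * T (r + 1)) ^ 2)"
      unfolding \<open>n = 2 * r\<close> psi.simps(7)[OF \<open>r \<ge> 3\<close>] ih
      by (simp only: T_def psi_tilde.simps(3) times_divide_eq_left)
    also have "\<dots> = T r / (y + 1) *
        ((g r / g 2 * (g (r + 2) * g (r - 1) ^ 2)) * (T (r + 2) * T (r - 1) ^ 2)
          - (g r / g 2 * (g (r - 2) * g (r + 1) ^ 2)) * (T (r - 2) * T (r + 1) ^ 2))"
      by (simp add: power_mult_distrib right_diff_distrib mult_ac)
    also have "\<dots> = g n * T n"
      unfolding \<open>n = 2 * r\<close> gauge_even_recurrence[OF r s \<open>x \<noteq> 0\<close> u, folded g_def]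
        T_def psi_tilde.simps(7)[OF \<open>r \<ge> 3\<close>] u_def
      by (simp add: right_diff_distrib mult_ac)
    finally show ?thesis .
  qed (simp add: T_def)
  then show ?case
    by (simp add: g_def T_def s_def u_def)
qed

section \<open>Evaluation of rational functions at a transcendental element\<close>

locale comm_ring_1_hom =
  fixes h :: "'a::comm_ring_1 \<Rightarrow> 'b::comm_ring_1"
  assumes hom_add: "h (p + q) = h p + h q"
    and hom_mult: "h (p * q) = h p * h q"
    and hom_one: "h 1 = 1"
begin

lemma hom_zero: "h 0 = 0"
  using hom_add[of 0 0] by simp

lemma hom_uminus: "h (- p) = - h p"
  using hom_add[of p "- p"] by (simp add: hom_zero eq_neg_iff_add_eq_0 add.commute)

lemma hom_diff: "h (p - q) = h p - h q"
  using hom_add[of p "- q"] by (simp add: hom_uminus)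

lemma hom_power: "h (p ^ n) = h p ^ n"
  by (induction n) (simp_all add: hom_one hom_mult)

lemma hom_of_nat: "h (of_nat n) = of_nat n"
  by (induction n) (simp_all add: hom_zero hom_one hom_add)

lemma hom_numeral: "h (numeral n) = numeral n"
  using hom_of_nat[of "numeral n"] by simp

lemmas hom_simps = hom_zero hom_one hom_add hom_mult hom_uminus hom_diff hom_power hom_numeral

lemma poly_map_poly_hom: "comm_ring_1_hom (\<lambda>p. poly (map_poly h p) z)"
proof
  have pCons: "poly (map_poly h (pCons c p)) z = h c + z * poly (map_poly h p) z" for c p
    by (simp add: map_poly_pCons hom_zero)
  show add: "poly (map_poly h (p + q)) z = poly (map_poly h p) z + poly (map_poly h q) z" for p q
    by (induction p q rule: poly_induct2) (simp_all add: pCons hom_add algebra_simps)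
  have smult: "poly (map_poly h (smult c p)) z = h c * poly (map_poly h p) z" for c p
    by (induction p) (simp_all add: pCons hom_mult algebra_simps)
  show "poly (map_poly h (p * q)) z = poly (map_poly h p) z * poly (map_poly h q) z" for p q
    by (induction p) (simp_all add: pCons add smult hom_zero algebra_simps)
  show "poly (map_poly h 1) z = 1"
    by (simp add: map_poly_1 hom_one)
qed

end

locale field_hom = comm_ring_1_hom h for h :: "'a::field \<Rightarrow> 'b::field"
begin

lemma hom_eq_0_iff: "h p = 0 \<longleftrightarrow> p = 0"
proof
  show "p = 0" if "h p = 0"
  proof (rule ccontr)
    assume "p \<noteq> 0"
    then have "h p * h (inverse p) = 1"
      by (simp flip: hom_mult add: hom_one)
    with that show False
      by simp
  qed
qed (simp add: hom_zero)

lemma hom_divide: "h (p / q) = h p / h q"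
proof (cases "q = 0")
  case False
  then have "h (p / q) * h q = h p" and "h q \<noteq> 0"
    by (simp_all flip: hom_mult add: hom_eq_0_iff)
  then show ?thesis
    by (simp add: field_simps)
qed (simp add: hom_zero)

text \<open>The recursion uses field operations only, so it commutes with field homomorphisms. With
  \<open>x / 0 = 0\<close> on both sides, this includes the division by \<open>y + 1\<close> when that is zero.\<close>

lemma psi_tilde_hom: "h (psi_tilde a d y n) = psi_tilde (h a) (h d) (h y) n"
proof (induction n rule: less_induct)
  case (less n)
  show ?case
  proof (cases n rule: recursion_cases)
    case (6 m)
    then have "h (psi_tilde a d y k) = psi_tilde (h a) (h d) (h y) k"
      if "k \<in> {m - 1, m, m + 1, m + 2}" for k
      using that by (intro less.IH) auto
    then show ?thesis
      unfolding \<open>n = 2 * m + 1\<close> psi_tilde.simps(6)[OF \<open>m \<ge> 2\<close>]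
      by (simp add: hom_simps hom_divide)
  next
    case (7 m)
    then have "h (psi_tilde a d y k) = psi_tilde (h a) (h d) (h y) k"
      if "k \<in> {m - 2, m - 1, m, m + 1, m + 2}" for k
      using that by (intro less.IH) auto
    then show ?thesis
      unfolding \<open>n = 2 * m\<close> psi_tilde.simps(7)[OF \<open>m \<ge> 3\<close>]
      by (simp add: hom_simps hom_divide)
  qed (simp_all only: psi_tilde.simps hom_simps)
qed

context
  fixes z :: 'b
  assumes transcendental: "\<And>q. q \<noteq> 0 \<Longrightarrow> poly (map_poly h q) z \<noteq> 0"
begin

text \<open>No nonzero denominator vanishes at a transcendental \<open>z\<close>, so every representation of a
  fraction is admissible in the definition of \<open>rat_eval\<close>, and all of them give the same value.\<close>

lemma rat_eval_Fract:
  assumes "q \<noteq> 0"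
  shows "rat_eval h z (Fract p q) = poly (map_poly h p) z / poly (map_poly h q) z"
  unfolding rat_eval_def
proof (rule the_equality)
  show "\<exists>p' q'. Fract p q = Fract p' q' \<and> poly (map_poly h q') z \<noteq> 0 \<and>
      poly (map_poly h p) z / poly (map_poly h q) z
        = poly (map_poly h p') z / poly (map_poly h q') z"
    using transcendental[OF assms] by blast
next
  interpret ev: comm_ring_1_hom "\<lambda>p. poly (map_poly h p) z"
    by (rule poly_map_poly_hom)
  fix w
  assume "\<exists>p' q'. Fract p q = Fract p' q' \<and> poly (map_poly h q') z \<noteq> 0 \<and>
      w = poly (map_poly h p') z / poly (map_poly h q') z"
  then obtain p' q' where eq: "Fract p q = Fract p' q'" and q': "poly (map_poly h q') z \<noteq> 0"
    and w: "w = poly (map_poly h p') z / poly (map_poly h q') z"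
    by blast
  from q' have "q' \<noteq> 0"
    by auto
  with eq assms have "p * q' = p' * q"
    by (simp add: eq_fract)
  then have "poly (map_poly h p) z * poly (map_poly h q') z
      = poly (map_poly h p') z * poly (map_poly h q) z"
    by (metis ev.hom_mult)
  then show "w = poly (map_poly h p) z / poly (map_poly h q) z"
    unfolding w using q' transcendental[OF assms] by (simp add: field_simps)
qed

lemma rat_eval_hom: "field_hom (rat_eval h z)"
proof
  interpret ev: comm_ring_1_hom "\<lambda>p. poly (map_poly h p) z"
    by (rule poly_map_poly_hom)
  show "rat_eval h z (r + s) = rat_eval h z r + rat_eval h z s" for r s
    by (cases r; cases s)
      (simp add: rat_eval_Fract transcendental ev.hom_add ev.hom_mult field_simps)
  show "rat_eval h z (r * s) = rat_eval h z r * rat_eval h z s" for r s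
    by (cases r; cases s) (simp add: rat_eval_Fract ev.hom_mult)
  show "rat_eval h z 1 = 1"
    by (simp add: One_fract_def rat_eval_Fract ev.hom_one)
qed

lemma rat_eval_psi_tilde:
  "rat_eval h z (psi_tilde_rat a d n) = psi_tilde (h a) (h d) z n"
proof -
  interpret ev: field_hom "rat_eval h z"
    by (rule rat_eval_hom)
  show ?thesis
    by (simp add: psi_tilde_rat_def ev.psi_tilde_hom rat_eval_Fract map_poly_pCons hom_zero hom_one)
qed

end

end

section \<open>The function field of the curve\<close>

lemma ring_of_type_algebra_simps:
  "carrier ring_of_type_algebra = UNIV"
  "p \<oplus>\<^bsub>ring_of_type_algebra\<^esub> q = p + q"
  "p \<otimes>\<^bsub>ring_of_type_algebra\<^esub> q = p * q"
  "\<one>\<^bsub>ring_of_type_algebra\<^esub> = 1"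
  "\<zero>\<^bsub>ring_of_type_algebra\<^esub> = 0"
  by (simp_all add: ring_of_type_algebra_def)

lemma curve_ideal_eq_multiples: "curve_ideal a d = {p. curve_poly a d dvd p}"
  by (auto simp: curve_ideal_def cgenideal_def ring_of_type_algebra_simps mult.commute)

lemma ideal_curve_ideal: "ideal (curve_ideal a d) poly_ring_xy"
  unfolding curve_ideal_def
  by (intro cring.cgenideal_ideal) (simp_all add: ring_of_type_algebra_simps cring_from_type_algebra)

lemma curve_poly_eq: "curve_poly a d = [:[:- 1, 0, a:], 0, [:1, 0, - d:]:]"
  by (simp add: curve_poly_def const_poly_def x_poly_def y_poly_def power2_eq_square one_pCons)

text \<open>As a polynomial in $y$ over $k[x]$, the equation of the curve has leading coefficient
  $1-dx^2$. Leading coefficients multiply, so that of every nonzero multiple is divisible by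
  $1-dx^2$. This excludes $x$ and all nonzero polynomials in $y$ alone from the ideal of the
  curve.\<close>

lemma degree_lead_coeff_curve_multiple:
  assumes "d \<noteq> 0" and "curve_poly a d dvd p" and "p \<noteq> 0"
  shows "degree (lead_coeff p) \<ge> 2"
proof -
  obtain q where p: "p = curve_poly a d * q"
    using assms(2) by blast
  have "lead_coeff (curve_poly a d) = [:1, 0, - d:]"
    by (simp add: curve_poly_eq)
  then have "lead_coeff p = [:1, 0, - d:] * lead_coeff q"
    by (simp only: p lead_coeff_mult)
  moreover have "lead_coeff q \<noteq> 0"
    using assms(3) p by auto
  ultimately show ?thesis
    using assms(1) by (simp add: degree_mult_eq del: mult_pCons_left)
qed

locale curve_function_field =
  fixes a d :: "'k::field" and \<iota> :: "'k poly poly set \<Rightarrow> 'f::field"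
  assumes char_neq_2: "CHAR('k) \<noteq> 2"
    and d_nonzero: "d \<noteq> 0"
    and function_field: "is_function_field a d \<iota>"
begin

sublocale comm_ring_1_hom "ff_of_poly a d \<iota>"
proof
  have proj: "(+>\<^bsub>poly_ring_xy\<^esub>) (curve_ideal a d) \<in> ring_hom poly_ring_xy (coordinate_ring a d)"
    unfolding coordinate_ring_def by (rule ideal.rcos_ring_hom[OF ideal_curve_ideal])
  have "\<iota> \<in> ring_hom (coordinate_ring a d) ring_of_type_algebra"
    using function_field by (simp add: is_function_field_def is_fraction_field_def)
  from ring_hom_trans[OF proj this]
  have hom: "ff_of_poly a d \<iota> \<in> ring_hom poly_ring_xy ring_of_type_algebra"
    by (simp add: ff_of_poly_def[abs_def] comp_def)
  show "ff_of_poly a d \<iota> (p + q) = ff_of_poly a d \<iota> p + ff_of_poly a d \<iota> q" for p q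
    using ring_hom_add[OF hom, of p q] by (simp add: ring_of_type_algebra_simps)
  show "ff_of_poly a d \<iota> (p * q) = ff_of_poly a d \<iota> p * ff_of_poly a d \<iota> q" for p q
    using ring_hom_mult[OF hom, of p q] by (simp add: ring_of_type_algebra_simps)
  show "ff_of_poly a d \<iota> 1 = 1"
    using ring_hom_one[OF hom] by (simp add: ring_of_type_algebra_simps)
qed

lemma ff_of_poly_eq_0_iff: "ff_of_poly a d \<iota> p = 0 \<longleftrightarrow> curve_poly a d dvd p"
proof -
  interpret I: ideal "curve_ideal a d" poly_ring_xy
    by (rule ideal_curve_ideal)
  have inj: "inj_on \<iota> (carrier (coordinate_ring a d))"
    using function_field by (simp add: is_function_field_def is_fraction_field_def)
  have carrier: "curve_ideal a d +>\<^bsub>poly_ring_xy\<^esub> q \<in> carrier (coordinate_ring a d)" for q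
    unfolding coordinate_ring_def FactRing_def A_RCOSETS_def' by (auto simp: ring_of_type_algebra_simps)
  have "ff_of_poly a d \<iota> p = 0 \<longleftrightarrow> ff_of_poly a d \<iota> p = ff_of_poly a d \<iota> 0"
    by (simp add: hom_zero)
  also have "\<dots> \<longleftrightarrow> curve_ideal a d +>\<^bsub>poly_ring_xy\<^esub> p = curve_ideal a d +>\<^bsub>poly_ring_xy\<^esub> 0"
    unfolding ff_of_poly_def using inj_on_eq_iff[OF inj carrier carrier] .
  also have "\<dots> \<longleftrightarrow> p \<in> curve_ideal a d"
    using I.quotient_eq_iff_same_a_r_cos[OF ideal_curve_ideal, of p 0]
      I.minus_zero
    by (simp add: ring_of_type_algebra_simps a_minus_def)
  finally show ?thesis
    by (simp add: curve_ideal_eq_multiples)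
qed

sublocale const: field_hom "ff_const a d \<iota>"
proof
  show "ff_const a d \<iota> (p + q) = ff_const a d \<iota> p + ff_const a d \<iota> q" for p q
    by (simp add: ff_const_def const_poly_def flip: hom_add)
  show "ff_const a d \<iota> (p * q) = ff_const a d \<iota> p * ff_const a d \<iota> q" for p q
    by (simp add: ff_const_def const_poly_def flip: hom_mult)
  show "ff_const a d \<iota> 1 = 1"
    by (simp add: ff_const_def const_poly_def hom_one flip: one_pCons)
qed

text \<open>Both sides evaluate \<open>q\<close> at the coordinate function $y$. On the right, \<open>q\<close> is first regarded
  as an element of $k[x][y]$ with constant coefficients, where membership in the ideal of the
  curve can be tested.\<close>

lemma poly_ff_y: "poly (map_poly (ff_const a d \<iota>) q) (ff_y a d \<iota>)
    = ff_of_poly a d \<iota> (map_poly (\<lambda>c. [:c:]) q)"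
proof (induction q)
  case (pCons c q)
  have "map_poly (\<lambda>c. [:c:]) (pCons c q) = const_poly c + y_poly * map_poly (\<lambda>c. [:c:]) q"
    by (simp add: map_poly_pCons const_poly_def y_poly_def)
  then show ?case
    by (simp add: map_poly_pCons const.hom_zero pCons.IH hom_add hom_mult flip: ff_const_def ff_y_def)
qed (simp add: hom_zero)

lemma ff_y_transcendental:
  assumes "q \<noteq> 0"
  shows "poly (map_poly (ff_const a d \<iota>) q) (ff_y a d \<iota>) \<noteq> 0"
proof
  let ?p = "map_poly (\<lambda>c. [:c:]) q"
  assume "poly (map_poly (ff_const a d \<iota>) q) (ff_y a d \<iota>) = 0"
  then have "curve_poly a d dvd ?p"
    by (simp add: poly_ff_y ff_of_poly_eq_0_iff)
  moreover have "?p \<noteq> 0"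
    using assms by (simp add: map_poly_eq_0_iff)
  ultimately have "degree (lead_coeff ?p) \<ge> 2"
    by (rule degree_lead_coeff_curve_multiple[OF d_nonzero])
  moreover have "degree (lead_coeff ?p) = 0"
    by (simp add: coeff_map_poly)
  ultimately show False
    by simp
qed

lemma ff_x_nonzero: "ff_x a d \<iota> \<noteq> 0"
proof
  assume "ff_x a d \<iota> = 0"
  then have "curve_poly a d dvd x_poly"
    by (simp add: ff_x_def ff_of_poly_eq_0_iff)
  then have "degree (lead_coeff (x_poly :: 'k poly poly)) \<ge> 2"
    by (rule degree_lead_coeff_curve_multiple[OF d_nonzero]) (simp add: x_poly_def)
  then show False
    by (simp add: x_poly_def)
qed

lemma ff_y_neq_const: "ff_y a d \<iota> \<noteq> ff_const a d \<iota> c"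
  using ff_y_transcendental[of "[:- c, 1:]"]
  by (auto simp: map_poly_pCons const.hom_simps)

lemma two_nonzero: "(2 :: 'f) \<noteq> 0"
proof -
  have "\<not> CHAR('k) dvd 2"
    using char_neq_2 CHAR_not_1[where 'a = 'k] two_is_prime_nat
    by (metis One_nat_def prime_nat_iff)
  then have "(2 :: 'k) \<noteq> 0"
    using of_nat_eq_0_iff_char_dvd[of 2, where 'a = 'k] by simp
  then show ?thesis
    by (metis const.hom_eq_0_iff const.hom_numeral)
qed

lemma curve_equation:
  "ff_const a d \<iota> a * ff_x a d \<iota> ^ 2 + ff_y a d \<iota> ^ 2
     = 1 + ff_const a d \<iota> d * ff_x a d \<iota> ^ 2 * ff_y a d \<iota> ^ 2"
proof -
  have "ff_of_poly a d \<iota> (curve_poly a d) = 0"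
    by (simp add: ff_of_poly_eq_0_iff)
  then show ?thesis
    by (simp add: curve_poly_def hom_simps ff_const_def ff_x_def ff_y_def algebra_simps)
qed

end

section \<open>The identity in the function field\<close>

theorem theorem6p1:
  fixes a d :: "'k::field"
    and \<iota> :: "'k poly poly set \<Rightarrow> 'f::field"
    and n :: nat
  assumes "CHAR('k) \<noteq> 2" and "CHAR('k) \<noteq> 3"
    and "a \<noteq> d" and "a \<noteq> 0" and "d \<noteq> 0"
    and "is_function_field a d \<iota>"
  shows "psi_ff a d \<iota> n =
    (if odd n then
       ff_const a d \<iota> (a - d) ^ k_exp n * psi_tilde_ff a d \<iota> n
         / (2 * (1 - ff_y a d \<iota>)) powi m_exp n
     else
       ff_const a d \<iota> (a - d) ^ k_exp n * psi_tilde_ff a d \<iota> n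
         / (ff_x a d \<iota> * (2 * (1 - ff_y a d \<iota>)) powi m_exp n))"
proof -
  interpret curve_function_field a d \<iota>
    by unfold_locales (fact assms)+
  let ?c = "ff_const a d \<iota>" and ?x = "ff_x a d \<iota>" and ?y = "ff_y a d \<iota>"
  have y: "?y \<noteq> 1" "?y \<noteq> - 1"
    using ff_y_neq_const[of 1] ff_y_neq_const[of "- 1"] by (simp_all add: const.hom_simps)
  have "?c a \<noteq> ?c d"
    using \<open>a \<noteq> d\<close> const.hom_eq_0_iff[of "a - d"] by (simp add: const.hom_diff)
  then have "psi_ff a d \<iota> n
      = gauge (?c a - ?c d) (2 * (1 - ?y)) ?x n * psi_tilde (?c a) (?c d) ?y n"
    unfolding psi_ff_def
    by (intro psi_eq_gauge_psi_tilde curve_equation ff_x_nonzero y two_nonzero)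
  moreover have "psi_tilde_ff a d \<iota> n = psi_tilde (?c a) (?c d) ?y n"
    unfolding psi_tilde_ff_def by (rule const.rat_eval_psi_tilde[OF ff_y_transcendental])
  ultimately show ?thesis
    by (simp add: gauge_def const.hom_diff)
qed

end
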